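(* Let $0<\underline{\lambda}<\bar{\lambda}$ be real numbers and let $M\ge 2$ be an integer. Consider the dynamics on $\mathbb{R}^N$ $$x(t+1) = x(t) + \alpha\,(b - A x(t)) + \sum_{m=1}^{M-1} \beta_m \,(x(t-m)-x(t)),$$ where $A$ is a self-adjoint positive semidefinite linear map on $\mathbb{R}^N$ about which it is known a priori that all its nonzero eigenvalues lie in $[\underline{\lambda},\bar{\lambda}]$, $b\in\mathbb{R}^N$ is such that $\{s\in\mathbb{R}^N: As=b\}\neq\emptyset$, and $\alpha,\beta_1,\dots,\beta_{M-1}\in\mathbb{R}$ are constant gains to be chosen. Let $\nu=\nu(\alpha,\beta_1,\dots,\beta_{M-1})$ be the convergence speed guarantee of these dynamics (defined in the context). Put $$\mu=\frac{\bar{\lambda}-\underline{\lambda}}{\bar{\lambda}+\underline{\lambda}},\qquad \beta_{1*} = -\left(\frac{1}{\mu}-\sqrt{\frac{1}{\mu^2}-1}\right)^2,\qquad \alpha_*=\frac{2(1-\beta_{1*})}{\bar{\lambda}+\underline{\lambda}}.$$ Then $\nu$ is minimized over all $(\alpha,\beta_1,\dots,\beta_{M-1})\in\mathbb{R}^M$ by taking $\alpha=\alpha_*$, $\beta_1=\beta_{1*}$ and $\beta_m=0$ for all $m>1$, and the corresponding (minimal) value is $$\nu_* = \frac{1}{\mu}-\sqrt{\frac{1}{\mu^2}-1}=\sqrt{-\beta_{1*}}\in(0,1).$$ That is, $\nu(\alpha_*,\beta_{1*},0,\dots,0)=\nu_*$ and $\nu(\alpha,\beta_1,\dots,\beta_{M-1})\ge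 \nu_*$ for all $\alpha,\beta_1,\dots,\beta_{M-1}\in\mathbb{R}$.
   Context: In an orthonormal eigenbasis of $A$ the dynamics decouple into scalar linear difference equations, one for each eigenvalue $\lambda_k$ of $A$: $$\tilde{x}_k(t+1) = (1-\alpha\lambda_k)\,\tilde{x}_k(t)+\alpha\tilde{b}_k+\sum_{m=1}^{M-1}\beta_m\,(\tilde{x}_k(t-m)-\tilde{x}_k(t)).$$ The characteristic polynomial of this equation with $\lambda_k$ replaced by $\lambda$ is $$P(z;\lambda)=z^M-(1-\alpha\lambda)z^{M-1}+\sum_{m=1}^{M-1}\beta_m\,(z^{M-1}-z^{M-1-m}).$$ Let $\gamma_1(\lambda),\dots,\gamma_M(\lambda)\in\mathbb{C}$ be the roots of $P(\cdot;\lambda)$, counted with multiplicity. For fixed $\alpha,\beta_1,\dots,\beta_{M-1}$, the convergence speed guarantee is $$\nu := \max_{\lambda\in[\underline{\lambda},\bar{\lambda}]}\ \max_{m\in\{1,\dots,M\}}|\gamma_m(\lambda)|,$$ i.e. the worst root modulus over the whole interval $[\underline{\lambda},\bar{\lambda}]$; it depends only on the gains and the interval, not on the particular $A$. *)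

theory Defs
  imports "HOL-Analysis.Analysis" "HOL-Computational_Algebra.Fundamental_Theorem_Algebra"
begin

text \<open>
  The gains \<open>\<beta>\<^sub>1, \<dots>, \<beta>\<^bsub>M-1\<^esub>\<close> are given by a function on \<^typ>\<open>nat\<close> of which only the values on
  \<open>{1..M-1}\<close> are ever used. The state \<open>x t\<close> with \<open>t < M\<close> is the free initial data.
\<close>

definition trajectory ::
  "('v::real_inner \<Rightarrow> 'v) \<Rightarrow> 'v \<Rightarrow> nat \<Rightarrow> real \<Rightarrow> (nat \<Rightarrow> real) \<Rightarrow> (nat \<Rightarrow> 'v) \<Rightarrow> bool" where
  "trajectory A b M \<alpha> \<beta> x \<longleftrightarrow>
     (\<forall>t \<ge> M - 1. x (t + 1) = x t + \<alpha> *\<^sub>R (b - A (x t)) + (\<Sum>m=1..M-1. \<beta> m *\<^sub>R (x (t - m) - x t)))"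

definition char_poly :: "nat \<Rightarrow> real \<Rightarrow> (nat \<Rightarrow> real) \<Rightarrow> real \<Rightarrow> complex poly" where
  "char_poly M \<alpha> \<beta> lam =
     monom 1 M - smult (of_real (1 - \<alpha> * lam)) (monom 1 (M - 1))
     + (\<Sum>m=1..M-1. smult (of_real (\<beta> m)) (monom 1 (M - 1) - monom 1 (M - 1 - m)))"

definition max_root_modulus :: "nat \<Rightarrow> real \<Rightarrow> (nat \<Rightarrow> real) \<Rightarrow> real \<Rightarrow> real" where
  "max_root_modulus M \<alpha> \<beta> lam = Max (cmod ` {z. poly (char_poly M \<alpha> \<beta> lam) z = 0})"

text \<open>The supremum is attained, hence a maximum: see \<open>speed_guarantee_is_max\<close> below.\<close>

definition speed_guarantee ::
  "real \<Rightarrow> real \<Rightarrow> nat \<Rightarrow> real \<Rightarrow> (nat \<Rightarrow> real) \<Rightarrow> real" where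
  "speed_guarantee lo hi M \<alpha> \<beta> = (SUP lam\<in>{lo..hi}. max_root_modulus M \<alpha> \<beta> lam)"

lemma trajectory_modal:
  assumes x: "trajectory A b M \<alpha> \<beta> x" and t: "t \<ge> M - 1"
    and A: "\<And>u w. A u \<bullet> w = u \<bullet> A w" and v: "A v = lam *\<^sub>R v"
  shows "x (t + 1) \<bullet> v = (1 - \<alpha> * lam) * (x t \<bullet> v) + \<alpha> * (b \<bullet> v)
           + (\<Sum>m=1..M-1. \<beta> m * (x (t - m) \<bullet> v - x t \<bullet> v))"
proof -
  have Ax: "A (x t) \<bullet> v = lam * (x t \<bullet> v)"
    by (simp add: A v)
  have step: "x (t + 1) = x t + \<alpha> *\<^sub>R (b - A (x t)) + (\<Sum>m=1..M-1. \<beta> m *\<^sub>R (x (t - m) - x t))"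
    using x t by (simp add: trajectory_def)
  show ?thesis
    unfolding step inner_add_left inner_diff_left inner_sum_left inner_scaleR_left Ax
    by (simp add: left_diff_distrib right_diff_distrib)
qed

lemma poly_char_poly:
  "poly (char_poly M \<alpha> \<beta> lam) z =
     z ^ M - of_real (1 - \<alpha> * lam) * z ^ (M - 1)
     + (\<Sum>m=1..M-1. of_real (\<beta> m) * (z ^ (M - 1) - z ^ (M - 1 - m)))"
  by (simp add: char_poly_def poly_sum poly_monom)

lemma char_poly_characteristic:
  assumes "M \<ge> 1" "z \<noteq> 0"
  shows "(\<forall>t \<ge> M - 1. z ^ (t + 1) = of_real (1 - \<alpha> * lam) * z ^ t
            + (\<Sum>m=1..M-1. of_real (\<beta> m) * (z ^ (t - m) - z ^ t)))
         \<longleftrightarrow> poly (char_poly M \<alpha> \<beta> lam) z = 0" (is "(\<forall>t \<ge> M - 1. ?L t = ?R t) \<longleftrightarrow> _")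
proof -
  have diff: "?L t - ?R t = z ^ (t - (M - 1)) * poly (char_poly M \<alpha> \<beta> lam) z" if t: "t \<ge> M - 1" for t
  proof -
    define s where "s = t - (M - 1)"
    have ts: "t = s + (M - 1)" "t + 1 = s + M"
      using t assms(1) by (auto simp: s_def)
    have sum: "(\<Sum>m=1..M-1. of_real (\<beta> m) * (z ^ (t - m) - z ^ t))
        = - (z ^ s * (\<Sum>m=1..M-1. of_real (\<beta> m) * (z ^ (M - 1) - z ^ (M - 1 - m))))"
      unfolding sum_distrib_left sum_negf[symmetric]
    proof (rule sum.cong[OF refl])
      fix m assume "m \<in> {1..M-1}"
      then have "t - m = s + (M - 1 - m)"
        using ts(1) by auto
      then show "of_real (\<beta> m) * (z ^ (t - m) - z ^ t)
        = - (z ^ s * (of_real (\<beta> m) * (z ^ (M - 1) - z ^ (M - 1 - m))))"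
        by (simp only: ts(1)[symmetric] power_add) (simp add: ts(1) power_add algebra_simps)
    qed
    have zt: "z ^ t = z ^ s * z ^ (M - 1)"
      by (simp only: ts(1) power_add)
    have zt1: "z ^ (t + 1) = z ^ s * z ^ M"
      by (simp only: ts(2) power_add)
    show ?thesis
      unfolding poly_char_poly s_def[symmetric] sum unfolding zt zt1
      by (simp only: distrib_left right_diff_distrib mult.left_commute[of "z ^ s"]) simp
  qed
  have "?L t = ?R t \<longleftrightarrow> poly (char_poly M \<alpha> \<beta> lam) z = 0" if "t \<ge> M - 1" for t
  proof -
    have "?L t = ?R t \<longleftrightarrow> ?L t - ?R t = 0"
      by (rule eq_iff_diff_eq_0)
    also have "\<dots> \<longleftrightarrow> poly (char_poly M \<alpha> \<beta> lam) z = 0"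
      unfolding diff[OF that] using assms(2) by simp
    finally show ?thesis .
  qed
  then show ?thesis
    by blast
qed

lemma char_poly_monic:
  assumes "M \<ge> 1"
  shows "degree (char_poly M \<alpha> \<beta> lam) = M" "lead_coeff (char_poly M \<alpha> \<beta> lam) = 1"
proof -
  have c: "coeff (char_poly M \<alpha> \<beta> lam) k = (if k = M then 1 else 0)" if "k \<ge> M" for k
    using that assms by (auto simp: char_poly_def coeff_sum intro!: sum.neutral)
  show d: "degree (char_poly M \<alpha> \<beta> lam) = M"
    by (rule antisym) (auto intro!: degree_le le_degree simp: c)
  show "lead_coeff (char_poly M \<alpha> \<beta> lam) = 1"
    by (simp add: d c)
qed

lemma char_poly_roots:
  assumes "M \<ge> 1"
  shows "finite {z. poly (char_poly M \<alpha> \<beta> lam) z = 0}"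
    and "{z. poly (char_poly M \<alpha> \<beta> lam) z = 0} \<noteq> {}"
proof -
  have d: "degree (char_poly M \<alpha> \<beta> lam) = M"
    by (rule char_poly_monic[OF assms])
  then have "char_poly M \<alpha> \<beta> lam \<noteq> 0"
    using assms by auto
  then show "finite {z. poly (char_poly M \<alpha> \<beta> lam) z = 0}"
    by (rule poly_roots_finite)
  show "{z. poly (char_poly M \<alpha> \<beta> lam) z = 0} \<noteq> {}"
    using fundamental_theorem_of_algebra[of "char_poly M \<alpha> \<beta> lam"] d assms
    by (auto simp: constant_degree)
qed

lemma char_poly_root_bound:
  assumes "M \<ge> 1" and z: "poly (char_poly M \<alpha> \<beta> lam) z = 0"
  shows "cmod z \<le> 1 + \<bar>\<alpha>\<bar> * \<bar>lam\<bar> + 2 * (\<Sum>m=1..M-1. \<bar>\<beta> m\<bar>)"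
proof (cases "cmod z \<le> 1")
  case True
  moreover have "0 \<le> (\<Sum>m=1..M-1. \<bar>\<beta> m\<bar>)" "0 \<le> \<bar>\<alpha>\<bar> * \<bar>lam\<bar>"
    by (auto intro: sum_nonneg)
  ultimately show ?thesis by linarith
next
  case False
  define r where "r = cmod z ^ (M - 1)"
  have r: "r > 0"
    using False by (auto simp: r_def intro!: zero_less_power)
  let ?S = "\<Sum>m=1..M-1. of_real (\<beta> m) * (z ^ (M - 1) - z ^ (M - 1 - m))"
  have "cmod ?S \<le> (\<Sum>m=1..M-1. \<bar>\<beta> m\<bar> * (2 * r))"
  proof (rule sum_norm_le)
    fix m assume "m \<in> {1..M-1}"
    have "cmod (z ^ (M - 1 - m)) \<le> r"
      unfolding r_def norm_power using False by (intro power_increasing) auto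
    then have "cmod (z ^ (M - 1) - z ^ (M - 1 - m)) \<le> 2 * r"
      using norm_triangle_ineq4[of "z ^ (M - 1)" "z ^ (M - 1 - m)"] by (simp add: norm_power r_def)
    then show "cmod (of_real (\<beta> m) * (z ^ (M - 1) - z ^ (M - 1 - m))) \<le> \<bar>\<beta> m\<bar> * (2 * r)"
      by (simp add: norm_mult mult_left_mono)
  qed
  then have S: "cmod ?S \<le> 2 * (\<Sum>m=1..M-1. \<bar>\<beta> m\<bar>) * r"
    by (simp add: sum_distrib_left sum_distrib_right mult_ac)
  have "z * z ^ (M - 1) = of_real (1 - \<alpha> * lam) * z ^ (M - 1) - ?S"
    using z assms(1) by (simp add: poly_char_poly power_eq_if[of z M] algebra_simps)
  then have "cmod z * r \<le> cmod (of_real (1 - \<alpha> * lam) * z ^ (M - 1)) + cmod ?S"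
    by (metis norm_mult norm_power norm_triangle_ineq4 r_def)
  also have "cmod (of_real (1 - \<alpha> * lam) * z ^ (M - 1)) = \<bar>1 - \<alpha> * lam\<bar> * r"
    by (simp only: norm_mult norm_of_real norm_power r_def)
  finally have "cmod z * r \<le> (\<bar>1 - \<alpha> * lam\<bar> + 2 * (\<Sum>m=1..M-1. \<bar>\<beta> m\<bar>)) * r"
    using S by (simp add: algebra_simps)
  then have "cmod z \<le> \<bar>1 - \<alpha> * lam\<bar> + 2 * (\<Sum>m=1..M-1. \<bar>\<beta> m\<bar>)"
    using r by simp
  moreover have "\<bar>1 - \<alpha> * lam\<bar> \<le> 1 + \<bar>\<alpha>\<bar> * \<bar>lam\<bar>"
    using abs_triangle_ineq4[of 1 "\<alpha> * lam"] by (simp add: abs_mult)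
  ultimately show ?thesis by linarith
qed

lemma speed_guarantee_is_max:
  assumes "M \<ge> 1" "lo \<le> hi"
  shows "\<exists>lam\<in>{lo..hi}. speed_guarantee lo hi M \<alpha> \<beta> = max_root_modulus M \<alpha> \<beta> lam"
    and "\<forall>lam\<in>{lo..hi}. max_root_modulus M \<alpha> \<beta> lam \<le> speed_guarantee lo hi M \<alpha> \<beta>"
proof -
  define K where "K = {p. fst p \<in> {lo..hi} \<and> poly (char_poly M \<alpha> \<beta> (fst p)) (snd p) = 0}"
  let ?B = "1 + \<bar>\<alpha>\<bar> * (\<bar>lo\<bar> + \<bar>hi\<bar>) + 2 * (\<Sum>m=1..M-1. \<bar>\<beta> m\<bar>)"
  have "K \<subseteq> {lo..hi} \<times> cball 0 ?B"
  proof (clarsimp simp: K_def simp del: One_nat_def)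
    fix lam z
    assume l: "lo \<le> lam" "lam \<le> hi" and z: "poly (char_poly M \<alpha> \<beta> lam) z = 0"
    have "\<bar>\<alpha>\<bar> * \<bar>lam\<bar> \<le> \<bar>\<alpha>\<bar> * (\<bar>lo\<bar> + \<bar>hi\<bar>)"
      using l by (intro mult_left_mono) auto
    with char_poly_root_bound[OF assms(1) z] show "cmod z \<le> ?B"
      by linarith
  qed
  moreover have "bounded ({lo..hi} \<times> cball (0::complex) ?B)"
    by (intro bounded_Times bounded_cball bounded_closed_interval)
  ultimately have "bounded K"
    by (rule bounded_subset[rotated])
  moreover have "closed K"
    unfolding K_def poly_char_poly atLeastAtMost_iff
    by (intro closed_Collect_conj closed_Collect_le closed_Collect_eq continuous_intros)
  ultimately have "compact K"
    by (simp add: compact_eq_bounded_closed)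
  moreover have "K \<noteq> {}"
    using char_poly_roots(2)[OF assms(1), of \<alpha> \<beta> lo] assms(2) by (auto simp: K_def)
  moreover have "continuous_on K (\<lambda>p. cmod (snd p))"
    by (intro continuous_intros)
  ultimately obtain p where p: "p \<in> K" "\<forall>q\<in>K. cmod (snd q) \<le> cmod (snd p)"
    using continuous_attains_sup by blast
  have fin: "finite (cmod ` {z. poly (char_poly M \<alpha> \<beta> lam) z = 0})"
    and ne: "cmod ` {z. poly (char_poly M \<alpha> \<beta> lam) z = 0} \<noteq> {}" for lam
    using char_poly_roots[OF assms(1)] by simp_all
  have le: "max_root_modulus M \<alpha> \<beta> lam \<le> cmod (snd p)" if "lam \<in> {lo..hi}" for lam
    unfolding max_root_modulus_def using fin ne p(2) that by (force simp: K_def)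
  have "cmod (snd p) \<le> max_root_modulus M \<alpha> \<beta> (fst p)"
    unfolding max_root_modulus_def using p(1) by (intro Max_ge fin) (auto simp: K_def)
  then have eq: "max_root_modulus M \<alpha> \<beta> (fst p) = cmod (snd p)"
    using le[of "fst p"] p(1) by (auto simp: K_def intro: antisym)
  have "speed_guarantee lo hi M \<alpha> \<beta> = cmod (snd p)"
    unfolding speed_guarantee_def
    using p(1) eq le by (intro cSup_eq_maximum) (auto simp: K_def intro!: rev_image_eqI[of "fst p"])
  then show "\<exists>lam\<in>{lo..hi}. speed_guarantee lo hi M \<alpha> \<beta> = max_root_modulus M \<alpha> \<beta> lam"
    and "\<forall>lam\<in>{lo..hi}. max_root_modulus M \<alpha> \<beta> lam \<le> speed_guarantee lo hi M \<alpha> \<beta>"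
    using eq le p(1) by (auto simp: K_def intro!: bexI[of _ "fst p"])
qed

end

theory Submission
  imports Defs "HOL-Complex_Analysis.Conformal_Mappings"
begin

text \<open>
  The lower bound is an instance of the Schwarz lemma. Reversing the characteristic polynomial,
  \<open>w\<^sup>M P(1/w; \<lambda>) = q(w) + \<alpha> \<lambda> w\<close> with \<open>q(0) = 1\<close> and, because the memory terms only involve
  differences of states, \<open>q(1) = 0\<close>; neither \<open>q\<close> nor these two values depend on \<open>\<lambda>\<close>. If all roots for all
  \<open>\<lambda>\<close> in the interval have modulus at most \<open>\<sigma> < 1\<close>, then on the disc \<open>|w| < 1/\<sigma>\<close> the meromorphic
  function \<open>q(w)/w\<close> avoids the segment of all \<open>-\<alpha> \<lambda>\<close>. It sends \<open>0\<close> to \<open>\<infinity>\<close> and \<open>1\<close> to \<open>0\<close>. The complement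
  of the segment in the sphere is conformally a disc, through the inverse of the Joukowski map
  \<open>p \<mapsto> (p + 1/p)/2\<close>; normalising the segment to \<open>[-1, 1]\<close> moves \<open>0\<close> to \<open>1/\<mu>\<close>, whose Joukowski preimage
  in the disc is exactly \<open>\<nu>\<^sub>*\<close>. So a holomorphic map from the disc of radius \<open>1/\<sigma>\<close> to the unit disc
  fixes \<open>0\<close> and sends \<open>1\<close> to \<open>\<nu>\<^sub>*\<close>, and the Schwarz lemma gives \<open>\<nu>\<^sub>* \<le> \<sigma>\<close>
  (\<open>Schwarz_slit_sphere\<close>, \<open>joukowski_preimage_le_root_bound\<close>).

  For the starred gains the characteristic polynomial is a power of \<open>z\<close> times a real quadratic with
  constant term \<open>\<nu>\<^sub>*\<^sup>2\<close>, and \<open>\<alpha>\<^sub>*\<close> makes its discriminant nonpositive on the whole interval, with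
  equality at both ends. Its two roots are then complex conjugates of modulus \<open>\<nu>\<^sub>*\<close>, so the bound is
  attained (\<open>speed_guarantee_optimal_gains_le\<close>).
\<close>

section \<open>The Schwarz lemma for maps avoiding a segment\<close>

text \<open>
  The meromorphic function \<open>u(w)/w\<close> has a simple pole at \<open>0\<close> and avoids \<open>[-1, 1]\<close>. Composing it with the
  inverse Joukowski map \<open>\<zeta> \<mapsto> 1 / (\<zeta> + sqrt (\<zeta>\<^sup>2 - 1))\<close> gives \<open>p(w) = w / (u + sqrt (u\<^sup>2 - w\<^sup>2))\<close>, which is
  holomorphic across the pole. It remains in the unit disc because \<open>|p| = 1\<close> would make
  \<open>u/w = (p + 1/p)/2\<close> a point of \<open>[-1, 1]\<close>. The last hypothesis is \<open>u(a)/a = (v + 1/v)/2\<close> cleared of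
  denominators, so that \<open>v = p(a)\<close>.
\<close>

lemma Schwarz_slit_sphere:
  fixes u :: "complex \<Rightarrow> complex"
  assumes hol: "u holomorphic_on ball 0 1" and u0: "u 0 \<noteq> 0"
    and avoid: "\<And>w t. \<lbrakk>cmod w < 1; \<bar>t\<bar> \<le> 1\<rbrakk> \<Longrightarrow> u w \<noteq> of_real t * w"
    and a: "cmod a < 1" "a \<noteq> 0"
    and v: "cmod v \<le> 1" "2 * v * u a = a * (v\<^sup>2 + 1)"
  shows "cmod v \<le> cmod a"
proof -
  obtain s0 where s0: "s0 holomorphic_on ball 0 1"
      "\<And>w. w \<in> ball 0 1 \<Longrightarrow> (u w)\<^sup>2 - w\<^sup>2 = (s0 w)\<^sup>2"
  proof (rule contractible_imp_holomorphic_sqrt)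
    show "(\<lambda>w. (u w)\<^sup>2 - w\<^sup>2) holomorphic_on ball 0 1"
      by (intro holomorphic_intros hol)
    show "contractible (ball (0::complex) 1)"
      by (intro convex_imp_contractible convex_ball)
    show "(u w)\<^sup>2 - w\<^sup>2 \<noteq> 0" if "w \<in> ball 0 1" for w
      using avoid[of w 1] avoid[of w "-1"] that by (auto simp: power2_eq_iff)
  qed blast
  \<comment> \<open>The branch of the root agreeing with \<open>u\<close> at \<open>0\<close> keeps the denominator of \<open>p\<close> away from zero.\<close>
  define s where "s = (if s0 0 = u 0 then s0 else (\<lambda>w. - s0 w))"
  have s_hol: "s holomorphic_on ball 0 1"
    unfolding s_def using s0(1) by (auto intro: holomorphic_intros)
  have s_sq: "(s w)\<^sup>2 = (u w)\<^sup>2 - w\<^sup>2" if "cmod w < 1" for w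
    using s0(2)[of w] that by (simp add: s_def)
  have "s 0 = u 0"
    using s0(2)[of 0] by (auto simp: s_def power2_eq_iff)
  define S where "S w = u w + s w" for w
  have S_hol: "S holomorphic_on ball 0 1"
    unfolding S_def by (intro holomorphic_intros hol s_hol)
  have S_eq: "(S w)\<^sup>2 + w\<^sup>2 = 2 * u w * S w" if "cmod w < 1" for w
    using s_sq[OF that] by (simp add: S_def power2_eq_square algebra_simps)
  have S_nz: "S w \<noteq> 0" if "cmod w < 1" for w
  proof
    assume "S w = 0"
    with S_eq[OF that] have "w = 0"
      by simp
    with \<open>S w = 0\<close> \<open>s 0 = u 0\<close> u0 show False
      by (simp add: S_def)
  qed
  define p where "p w = w / S w" for w
  have p_hol: "p holomorphic_on ball 0 1"
    unfolding p_def by (intro holomorphic_intros S_hol) (auto simp: S_nz)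
  have p0: "p 0 = 0"
    by (simp add: p_def)
  have p_eq: "2 * p w * u w = w * ((p w)\<^sup>2 + 1)" if "cmod w < 1" for w
  proof -
    have "w * ((p w)\<^sup>2 + 1) = w * ((S w)\<^sup>2 + w\<^sup>2) / (S w)\<^sup>2"
      using S_nz[OF that] by (simp add: p_def power_divide add_divide_distrib distrib_left)
    also have "\<dots> = 2 * p w * u w"
      unfolding S_eq[OF that] using S_nz[OF that] by (simp add: p_def power2_eq_square)
    finally show ?thesis ..
  qed
  have p_ne: "cmod (p w) \<noteq> 1" if "cmod w < 1" for w
  proof
    assume 1: "cmod (p w) = 1"
    then have "p w \<noteq> 0" and pc: "p w * cnj (p w) = 1"
      by (auto simp: complex_norm_square[symmetric])
    have "(p w)\<^sup>2 + 1 = p w * (p w + cnj (p w))"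
      using pc by (simp add: power2_eq_square algebra_simps)
    also have "\<dots> = p w * (2 * of_real (Re (p w)))"
      by (simp add: complex_add_cnj)
    finally have "p w * (2 * u w) = p w * (2 * (of_real (Re (p w)) * w))"
      using p_eq[OF that] by (simp add: algebra_simps)
    then have "u w = of_real (Re (p w)) * w"
      using \<open>p w \<noteq> 0\<close> by simp
    moreover have "\<bar>Re (p w)\<bar> \<le> 1"
      using abs_Re_le_cmod[of "p w"] 1 by simp
    ultimately show False
      using avoid that by blast
  qed
  have p_lt: "cmod (p w) < 1" if "cmod w < 1" for w
  proof (rule ccontr)
    assume "\<not> cmod (p w) < 1"
    have "connected ((\<lambda>w. cmod (p w)) ` ball 0 1)"
      by (intro connected_continuous_image continuous_intros
          holomorphic_on_imp_continuous_on[OF p_hol] convex_connected convex_ball)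
    moreover have "0 \<in> (\<lambda>w. cmod (p w)) ` ball 0 1"
      by (rule image_eqI[of _ _ 0]) (simp_all add: p0)
    moreover have "cmod (p w) \<in> (\<lambda>w. cmod (p w)) ` ball 0 1"
      using that by auto
    ultimately have "1 \<in> (\<lambda>w. cmod (p w)) ` ball 0 1"
      using \<open>\<not> cmod (p w) < 1\<close> connectedD_interval[of _ 0 "cmod (p w)" 1] by simp
    then show False
      using p_ne by force
  qed
  have p_le: "cmod (p a) \<le> cmod a"
    by (rule Schwarz_Lemma(1)[OF p_hol p0 p_lt a(1)])
  have "a * (v * ((p a)\<^sup>2 + 1)) = a * (p a * (v\<^sup>2 + 1))"
    using p_eq[OF a(1)] v(2) by algebra
  then have "v * ((p a)\<^sup>2 + 1) = p a * (v\<^sup>2 + 1)"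
    using a(2) by simp
  then have "(p a - v) * (v * p a - 1) = 0"
    by (simp add: power2_eq_square algebra_simps)
  \<comment> \<open>The Joukowski map takes each value at \<open>p\<close> and at \<open>1/p\<close>, of which only one lies in the disc.\<close>
  then consider "p a = v" | "v * p a = 1"
    by auto
  then show ?thesis
  proof cases
    case 1
    with p_le show ?thesis by simp
  next
    case 2
    then have "cmod v * cmod (p a) = 1"
      by (metis norm_mult norm_one)
    moreover have "cmod v * cmod (p a) \<le> cmod (p a)"
      using v(1) by (simp add: mult_left_le_one_le)
    ultimately show ?thesis
      using p_lt[OF a(1)] by linarith
  qed
qed

section \<open>The lower bound\<close>

text \<open>The part of the reversed characteristic polynomial that does not involve \<open>\<alpha> \<lambda>\<close>, called \<open>q\<close> above.\<close>

definition reversed_free_poly :: "nat \<Rightarrow> (nat \<Rightarrow> real) \<Rightarrow> complex \<Rightarrow> complex" where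
  "reversed_free_poly M \<beta> w = 1 - w + (\<Sum>m=1..M-1. of_real (\<beta> m) * (w - w ^ (m + 1)))"

lemma reversed_free_poly_0: "reversed_free_poly M \<beta> 0 = 1"
  by (simp add: reversed_free_poly_def)

lemma reversed_free_poly_1: "reversed_free_poly M \<beta> 1 = 0"
  by (simp add: reversed_free_poly_def)

lemma holomorphic_reversed_free_poly:
  "f holomorphic_on A \<Longrightarrow> (\<lambda>w. reversed_free_poly M \<beta> (f w)) holomorphic_on A"
  unfolding reversed_free_poly_def by (intro holomorphic_intros)

lemma poly_char_poly_inverse:
  assumes M: "M \<ge> 1" and w: "w \<noteq> 0"
  shows "w ^ M * poly (char_poly M \<alpha> \<beta> lam) (1 / w) = reversed_free_poly M \<beta> w + of_real (\<alpha> * lam) * w"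
proof -
  have pw: "w ^ M * (1 / w) ^ k = w ^ (M - k)" if "k \<le> M" for k
    using w that by (simp add: power_diff power_one_over)
  have "w ^ M * (\<Sum>m=1..M-1. of_real (\<beta> m) * ((1 / w) ^ (M - 1) - (1 / w) ^ (M - 1 - m)))
      = (\<Sum>m=1..M-1. of_real (\<beta> m) * (w - w ^ (m + 1)))"
    unfolding sum_distrib_left
  proof (rule sum.cong[OF refl])
    fix m assume "m \<in> {1..M-1}"
    then have "M - (M - 1) = 1" "M - (M - 1 - m) = m + 1"
      by auto
    then have "w ^ M * (1 / w) ^ (M - 1) = w" "w ^ M * (1 / w) ^ (M - 1 - m) = w ^ (m + 1)"
      using pw[of "M - 1"] pw[of "M - 1 - m"] by simp_all
    then show "w ^ M * (of_real (\<beta> m) * ((1 / w) ^ (M - 1) - (1 / w) ^ (M - 1 - m)))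
        = of_real (\<beta> m) * (w - w ^ (m + 1))"
      by (metis mult.left_commute right_diff_distrib)
  qed
  moreover have "w ^ M * (1 / w) ^ M = 1"
    using pw[of M] by simp
  moreover have "w ^ M * (of_real (1 - \<alpha> * lam) * (1 / w) ^ (M - 1)) = of_real (1 - \<alpha> * lam) * w"
    using pw[of "M - 1"] M by (simp add: mult.left_commute)
  ultimately show ?thesis
    unfolding poly_char_poly reversed_free_poly_def
    by (simp only: distrib_left right_diff_distrib) (simp add: algebra_simps)
qed

text \<open>
  The affine map taking \<open>-\<alpha> \<lambda>\<close> to \<open>[-1, 1]\<close> turns \<open>q(w)/w\<close> into \<open>u(w)/w\<close> below; it divides by the signed
  half-length \<open>\<alpha> (hi - lo)/2\<close>, and either sign of \<open>\<alpha>\<close> sends \<open>0\<close> to the same point \<open>(hi + lo)/(hi - lo)\<close>. The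
  disc of radius \<open>1/\<sigma>\<close> is rescaled to the unit disc, which puts the point \<open>1\<close> at \<open>\<sigma>\<close>. For \<open>\<alpha> = 0\<close> the
  segment degenerates, but then every constant sequence solves the dynamics, so \<open>1\<close> is a root.
\<close>

lemma joukowski_preimage_le_root_bound:
  assumes M: "M \<ge> 1" and lohi: "lo < hi" and \<sigma>: "0 < \<sigma>" "\<sigma> < 1"
    and roots: "\<And>lam z. \<lbrakk>lam \<in> {lo..hi}; poly (char_poly M \<alpha> \<beta> lam) z = 0\<rbrakk> \<Longrightarrow> cmod z \<le> \<sigma>"
    and \<nu>: "\<bar>\<nu>\<bar> \<le> 1" "2 * \<nu> * ((hi + lo) / (hi - lo)) = \<nu>\<^sup>2 + 1"
  shows "\<bar>\<nu>\<bar> \<le> \<sigma>"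
proof -
  let ?q = "reversed_free_poly M \<beta>"
  have "\<alpha> \<noteq> 0"
  proof
    assume "\<alpha> = 0"
    then have "poly (char_poly M \<alpha> \<beta> lo) 1 = 0"
      by (simp add: poly_char_poly)
    with roots[of lo 1] lohi \<sigma> show False by simp
  qed
  define h c where "h = \<alpha> * (hi - lo) / 2" and "c = - \<alpha> * (hi + lo) / 2"
  have h: "h \<noteq> 0"
    using \<open>\<alpha> \<noteq> 0\<close> lohi by (simp add: h_def)
  define u where "u x = (of_real \<sigma> * ?q (x / of_real \<sigma>) - of_real c * x) / of_real h" for x :: complex
  have "cmod (of_real \<nu>) \<le> cmod (of_real \<sigma>)"
  proof (rule Schwarz_slit_sphere[of u])
    show "u holomorphic_on ball 0 1"
      unfolding u_def using h \<sigma>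
      by (intro holomorphic_intros holomorphic_reversed_free_poly) auto
    show "u 0 \<noteq> 0"
      using h \<sigma> by (simp add: u_def reversed_free_poly_0)
    show "u x \<noteq> of_real t * x" if x: "cmod x < 1" and t: "\<bar>t\<bar> \<le> 1" for x t
    proof
      assume eq: "u x = of_real t * x"
      with \<open>u 0 \<noteq> 0\<close> have "x \<noteq> 0" by auto
      define w where "w = x / of_real \<sigma>"
      define lam where "lam = (hi + lo) / 2 - t * ((hi - lo) / 2)"
      have "w \<noteq> 0" and xw: "x = of_real \<sigma> * w"
        using \<open>x \<noteq> 0\<close> \<sigma> by (simp_all add: w_def)
      have "\<bar>t * ((hi - lo) / 2)\<bar> \<le> 1 * ((hi - lo) / 2)"
        unfolding abs_mult using t lohi by (intro mult_mono) auto
      then have lam: "lam \<in> {lo..hi}"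
        unfolding lam_def by (auto simp: abs_le_iff field_simps)
      have "c + h * t = - (\<alpha> * lam)"
        by (simp add: c_def h_def lam_def field_simps)
      then have ch: "of_real c + of_real h * of_real t = (- of_real (\<alpha> * lam) :: complex)"
        by (metis of_real_add of_real_minus of_real_mult)
      have "of_real \<sigma> * ?q w = (of_real c + of_real h * of_real t) * x"
        using eq h by (simp add: u_def w_def[symmetric] field_simps)
      then have "of_real \<sigma> * (?q w + of_real (\<alpha> * lam) * w) = 0"
        by (simp add: ch xw algebra_simps)
      then have "?q w + of_real (\<alpha> * lam) * w = 0"
        using \<sigma> by (simp only: mult_eq_0_iff of_real_eq_0_iff) auto
      then have "poly (char_poly M \<alpha> \<beta> lam) (1 / w) = 0"
        using poly_char_poly_inverse[OF M \<open>w \<noteq> 0\<close>, of \<alpha> \<beta> lam] \<open>w \<noteq> 0\<close> by simp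
      from roots[OF lam this] have "1 \<le> \<sigma> * cmod w"
        using \<open>w \<noteq> 0\<close> by (simp add: norm_divide field_simps)
      also have "\<dots> = cmod x"
        using \<sigma> by (simp add: xw norm_mult)
      finally show False
        using x by simp
    qed
    show "cmod (of_real \<sigma>) < 1" "of_real \<sigma> \<noteq> (0::complex)" "cmod (of_real \<nu>) \<le> 1"
      using \<sigma> \<nu> by simp_all
    have "- c / h = (hi + lo) / (hi - lo)"
      using \<open>\<alpha> \<noteq> 0\<close> lohi by (simp add: c_def h_def field_simps)
    then have "2 * \<nu> * (\<sigma> * (- c / h)) = \<sigma> * (\<nu>\<^sup>2 + 1)"
      by (simp only: mult.left_commute[of _ \<sigma>] \<nu>(2))
    then have "of_real (2 * \<nu> * (\<sigma> * (- c / h))) = (of_real (\<sigma> * (\<nu>\<^sup>2 + 1)) :: complex)"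
      by (simp only:)
    moreover have "u (of_real \<sigma>) = of_real (\<sigma> * (- c / h))"
      using \<sigma> by (simp add: u_def reversed_free_poly_1)
    ultimately show "2 * of_real \<nu> * u (of_real \<sigma>) = of_real \<sigma> * ((of_real \<nu>)\<^sup>2 + 1)"
      by (simp only: of_real_mult of_real_add of_real_power of_real_numeral of_real_1)
  qed
  then show ?thesis
    using \<sigma> by simp
qed

lemma root_le_speed_guarantee:
  assumes "M \<ge> 1" "lam \<in> {lo..hi}" "poly (char_poly M \<alpha> \<beta> lam) z = 0"
  shows "cmod z \<le> speed_guarantee lo hi M \<alpha> \<beta>"
proof -
  have "cmod z \<le> max_root_modulus M \<alpha> \<beta> lam"
    unfolding max_root_modulus_def using char_poly_roots(1)[OF assms(1)] assms(3)
    by (intro Max_ge) auto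
  also have "\<dots> \<le> speed_guarantee lo hi M \<alpha> \<beta>"
    using speed_guarantee_is_max(2)[of M lo hi \<alpha> \<beta>] assms by auto
  finally show ?thesis .
qed

lemma joukowski_preimage_le_speed_guarantee:
  assumes M: "M \<ge> 1" and lohi: "lo < hi"
    and \<nu>: "\<bar>\<nu>\<bar> \<le> 1" "2 * \<nu> * ((hi + lo) / (hi - lo)) = \<nu>\<^sup>2 + 1"
  shows "\<bar>\<nu>\<bar> \<le> speed_guarantee lo hi M \<alpha> \<beta>"
proof (rule ccontr)
  let ?s = "speed_guarantee lo hi M \<alpha> \<beta>"
  assume "\<not> \<bar>\<nu>\<bar> \<le> ?s"
  moreover have "\<nu> \<noteq> 0"
    using \<nu>(2) by auto
  ultimately have "max ?s 0 < \<bar>\<nu>\<bar>"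
    by simp
  \<comment> \<open>Strictly between, as \<open>\<sigma>\<close> must be positive although all roots might be zero.\<close>
  then obtain \<sigma> where \<sigma>: "max ?s 0 < \<sigma>" "\<sigma> < \<bar>\<nu>\<bar>"
    using dense by blast
  have "\<bar>\<nu>\<bar> \<le> \<sigma>"
    using root_le_speed_guarantee[OF M, of _ lo hi \<alpha> \<beta>] \<sigma> \<nu>
    by (intro joukowski_preimage_le_root_bound[OF M lohi _ _ _ \<nu>, of \<sigma> \<alpha> \<beta>]) fastforce+
  with \<sigma> show False by simp
qed

section \<open>The optimal gains\<close>

text \<open>
  A nonpositive discriminant forces every root to have real part \<open>a/2\<close>, whether it is real (then double)
  or not; the real part of the equation then reads \<open>|z|\<^sup>2 = r\<^sup>2\<close>.
\<close>

lemma cmod_root_real_quadratic: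
  assumes z: "z\<^sup>2 - of_real a * z + of_real (r\<^sup>2) = 0" and a: "\<bar>a\<bar> \<le> 2 * r"
  shows "cmod z = r"
proof -
  define x y where "x = Re z" and "y = Im z"
  have re: "x\<^sup>2 - y\<^sup>2 - a * x + r\<^sup>2 = 0" and im: "(2 * x - a) * y = 0"
    using arg_cong[OF z, of Re] arg_cong[OF z, of Im]
    by (simp_all add: x_def y_def power2_eq_square algebra_simps)
  have "r \<ge> 0"
    using a by linarith
  have "2 * x - a = 0"
  proof (cases "y = 0")
    case True
    have "a\<^sup>2 \<le> (2 * r)\<^sup>2"
      using a \<open>r \<ge> 0\<close> abs_le_square_iff[of a "2 * r"] by simp
    moreover have "(2 * x - a)\<^sup>2 = a\<^sup>2 - (2 * r)\<^sup>2"
      using re True by (simp add: power2_eq_square algebra_simps)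
    ultimately show ?thesis
      using power2_less_eq_zero_iff[of "2 * x - a"] by linarith
  next
    case False
    with im show ?thesis by simp
  qed
  then have "a * x = 2 * x\<^sup>2"
    by (simp add: power2_eq_square)
  with re have "x\<^sup>2 + y\<^sup>2 = r\<^sup>2"
    by linarith
  then show ?thesis
    using \<open>r \<ge> 0\<close> by (simp add: cmod_def x_def y_def)
qed

lemma poly_char_poly_two_gains:
  assumes M: "M \<ge> 2"
  shows "poly (char_poly M \<alpha> (\<lambda>m. if m = 1 then \<beta> else 0) lam) z
    = z ^ (M - 2) * (z\<^sup>2 - of_real (1 - \<beta> - \<alpha> * lam) * z + of_real (- \<beta>))"
proof -
  define k where "k = M - 2"
  have k: "M = Suc (Suc k)"
    using M by (simp add: k_def)
  have "(\<Sum>m=1..M-1. of_real (if m = 1 then \<beta> else 0) * (z ^ (M - 1) - z ^ (M - 1 - m)))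
      = (\<Sum>m=1..M-1. if m = 1 then of_real \<beta> * (z ^ (M - 1) - z ^ (M - 2)) else 0)"
    by (intro sum.cong) (auto simp: numeral_2_eq_2)
  also have "\<dots> = of_real \<beta> * (z ^ (M - 1) - z ^ (M - 2))"
    using M by simp
  finally show ?thesis
    unfolding poly_char_poly by (simp add: k power2_eq_square algebra_simps)
qed

text \<open>
  The gain \<open>2 (1 + \<nu>\<^sup>2)/(hi + lo)\<close> centres the linear coefficient \<open>1 + \<nu>\<^sup>2 - \<alpha> \<lambda>\<close>, which then ranges over
  \<open>[-2 \<nu>, 2 \<nu>]\<close> by the Joukowski equation for \<open>\<nu>\<close>.
\<close>

lemma speed_guarantee_optimal_gains_le:
  assumes M: "M \<ge> 2" and lohi: "0 < lo" "lo < hi"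
    and \<nu>: "0 \<le> \<nu>" "2 * \<nu> * ((hi + lo) / (hi - lo)) = \<nu>\<^sup>2 + 1"
  shows "speed_guarantee lo hi M (2 * (1 + \<nu>\<^sup>2) / (hi + lo)) (\<lambda>m. if m = 1 then - \<nu>\<^sup>2 else 0) \<le> \<nu>"
    (is "speed_guarantee lo hi M ?\<alpha> ?\<beta> \<le> \<nu>")
proof -
  have M1: "M \<ge> 1"
    using M by simp
  have "max_root_modulus M ?\<alpha> ?\<beta> lam \<le> \<nu>" if lam: "lam \<in> {lo..hi}" for lam
  proof -
    have "cmod z \<le> \<nu>" if "poly (char_poly M ?\<alpha> ?\<beta> lam) z = 0" for z
    proof (cases "z = 0")
      case True
      with \<nu>(1) show ?thesis by simp
    next
      case False
      let ?a = "1 + \<nu>\<^sup>2 - ?\<alpha> * lam"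
      have "z\<^sup>2 - of_real ?a * z + of_real (\<nu>\<^sup>2) = 0"
        using that False unfolding poly_char_poly_two_gains[OF M] by simp
      moreover have "\<bar>?a\<bar> \<le> 2 * \<nu>"
      proof -
        have "?a = (\<nu>\<^sup>2 + 1) * (hi + lo - 2 * lam) / (hi + lo)"
          using lohi by (simp add: field_simps)
        also have "\<dots> = 2 * \<nu> * ((hi + lo - 2 * lam) / (hi - lo))"
          unfolding \<nu>(2)[symmetric] using lohi by simp
        finally have "\<bar>?a\<bar> = 2 * \<nu> * \<bar>(hi + lo - 2 * lam) / (hi - lo)\<bar>"
          using \<nu>(1) by (simp add: abs_mult)
        also have "\<dots> \<le> 2 * \<nu> * 1"
          using lam lohi \<nu>(1) by (intro mult_left_mono) (auto simp: abs_le_iff field_simps)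
        finally show ?thesis by simp
      qed
      ultimately show ?thesis
        using cmod_root_real_quadratic by fastforce
    qed
    then show ?thesis
      unfolding max_root_modulus_def using char_poly_roots[OF M1] by (subst Max_le_iff) auto
  qed
  then show ?thesis
    using speed_guarantee_is_max(1)[OF M1, of lo hi ?\<alpha> ?\<beta>] lohi by fastforce
qed

lemma joukowski_preimage_real:
  fixes k :: real
  assumes "k > 1"
  defines "\<nu> \<equiv> k - sqrt (k\<^sup>2 - 1)"
  shows "0 < \<nu>" "\<nu> < 1" "2 * \<nu> * k = \<nu>\<^sup>2 + 1"
proof -
  have k2: "1 < k\<^sup>2"
    using assms(1) by (simp add: one_less_power)
  then have sq: "(sqrt (k\<^sup>2 - 1))\<^sup>2 = k\<^sup>2 - 1"
    by simp
  have "sqrt (k\<^sup>2 - 1) < sqrt (k\<^sup>2)"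
    by (intro real_sqrt_less_mono) simp
  then show "0 < \<nu>"
    using assms(1) by (simp add: \<nu>_def)
  have "(k - 1)\<^sup>2 < k\<^sup>2 - 1"
    using assms(1) by (simp add: power2_eq_square algebra_simps)
  then have "k - 1 < sqrt (k\<^sup>2 - 1)"
    by (rule real_less_rsqrt)
  then show "\<nu> < 1"
    by (simp add: \<nu>_def)
  show "2 * \<nu> * k = \<nu>\<^sup>2 + 1"
    using sq by (simp add: \<nu>_def power2_eq_square algebra_simps)
qed

theorem theorem3:
  fixes lo hi \<mu> \<beta>1s \<alpha>s \<nu>s :: real and M :: nat
    and A :: "real ^ 'n \<Rightarrow> real ^ 'n" and b :: "real ^ 'n"
  assumes "0 < lo" and "lo < hi" and "M \<ge> 2"
    and "linear A" and "adjoint A = A" and "\<forall>v. 0 \<le> v \<bullet> A v"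
    and "\<forall>lam v. v \<noteq> 0 \<and> A v = lam *\<^sub>R v \<and> lam \<noteq> 0 \<longrightarrow> lam \<in> {lo..hi}"
    and "{s. A s = b} \<noteq> {}"
    and "\<mu> = (hi - lo) / (hi + lo)"
    and "\<beta>1s = - (1 / \<mu> - sqrt (1 / \<mu>\<^sup>2 - 1))\<^sup>2"
    and "\<alpha>s = 2 * (1 - \<beta>1s) / (hi + lo)"
    and "\<nu>s = 1 / \<mu> - sqrt (1 / \<mu>\<^sup>2 - 1)"
  shows "speed_guarantee lo hi M \<alpha>s (\<lambda>m. if m = 1 then \<beta>1s else 0) = \<nu>s
    \<and> (\<forall>\<alpha> \<beta>. speed_guarantee lo hi M \<alpha> \<beta> \<ge> \<nu>s)
    \<and> \<nu>s = sqrt (- \<beta>1s) \<and> 0 < \<nu>s \<and> \<nu>s < 1"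
proof -
  have mu: "1 / \<mu> = (hi + lo) / (hi - lo)"
    using assms(9) by simp
  have "1 / \<mu> > 1"
    unfolding mu using assms(1,2) by simp
  from joukowski_preimage_real[OF this]
  have \<nu>: "0 < \<nu>s" "\<nu>s < 1" "2 * \<nu>s * ((hi + lo) / (hi - lo)) = \<nu>s\<^sup>2 + 1"
    unfolding assms(12) mu[symmetric] by (simp_all add: power_one_over)
  have \<beta>: "\<beta>1s = - \<nu>s\<^sup>2"
    using assms(10,12) by simp
  have \<alpha>: "\<alpha>s = 2 * (1 + \<nu>s\<^sup>2) / (hi + lo)"
    using assms(11) \<beta> by simp
  have lower: "\<nu>s \<le> speed_guarantee lo hi M \<alpha> \<beta>" for \<alpha> \<beta>
    using joukowski_preimage_le_speed_guarantee[of M lo hi \<nu>s \<alpha> \<beta>] assms(2,3) \<nu> by simp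
  have upper: "speed_guarantee lo hi M \<alpha>s (\<lambda>m. if m = 1 then \<beta>1s else 0) \<le> \<nu>s"
    unfolding \<alpha> \<beta> by (rule speed_guarantee_optimal_gains_le) (use assms(1-3) \<nu> in auto)
  show ?thesis
    using lower upper \<nu> \<beta> by (auto intro: antisym)
qed

end
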